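(* Let $d\ge 2$, $m\ge 1$, $\omega\in\Omega_{d,m}$, let $G=G_\omega$ be the corresponding spinal group with spinal generating set $S$, and let $\Gamma_n$ be the Schreier graph of $G$ on the $n$-th level $X^n$ of the tree $T_d$ with respect to $S$. Then $$\Gamma_1=\operatorname{Star}(\Theta,\Xi,\emptyset),\qquad \Gamma_n=\operatorname{Star}(\Lambda_{\omega_{n-2}},\Gamma_{n-1},(d-1)^{n-2}0)\quad\text{for all } n\ge 2,$$ where $\Xi$, $\Theta$ and $\Lambda_\pi$ are the following graphs. - $\Xi$ is a graph with one vertex, labeled $\emptyset$ (the empty word), which has $d^m-1$ loops, each labeled with a different non-trivial element of $B$. - $\Theta$ is a graph with $d$ vertices, labeled $0,\dots,d-1$. There is an edge labeled by $a^j$ from $i$ to $i+j$ (mod $d$), for every $i\in X$ and every $1\le j\le d-1$. - For $\pi\in\operatorname{Epi}(B,A)$, $\Lambda_\pi$ is a graph with $d$ vertices, labeled $0,\dots,d-1$. For every $b\in B\setminus\{1\}$, let $j$ be such that $\pi(b)=a^j$; then, for every vertex $i$, there is an edge labeled by $b$ from $i$ to $i+j$ (mod $d$). (This implies adding loops for the $b\in\operatorname{Ker}(\pi)$.)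
   Context: Let $X=\{0,\dots,d-1\}$ with addition modulo $d$. $T_d$ is the $d$-ary rooted tree with vertex set $X^*$ (finite words over $X$) and $n$-th level $X^n$. Let $a\in\operatorname{Aut}(T_d)$, $a(v_0v_1\dots v_n)=(v_0+1)v_1\dots v_n$, and $A=\langle a\rangle\cong\mathbb{Z}/d\mathbb{Z}$. Let $B=(\mathbb{Z}/d\mathbb{Z})^m$ and let $\operatorname{Epi}(B,A)$ be the set of surjective homomorphisms $B\to A$. $\Omega_{d,m}$ is the set of sequences $\omega=(\omega_n)_{n\ge 0}$ in $\operatorname{Epi}(B,A)$ with $\bigcap_{j\ge i}\operatorname{Ker}(\omega_j)=1$ for all $i\ge 0$. For $b\in B$, $b_\omega\in\operatorname{Aut}(T_d)$ sends a word of the form $(d-1)^r0v_{r+1}v_{r+2}\dots v_n$ ($r\ge 0$) to $(d-1)^r0\,\omega_r(b)(v_{r+1})\,v_{r+2}\dots v_n$ (where $\omega_r(b)=a^j$ acts on letters by $i\mapsto i+j$) and fixes all other words. The group $B$ is identified with $B_\omega=\{b_\omega\mid b\in B\}$. The spinal group is $G_\omega=\langle A,B_\omega\rangle\le\operatorname{Aut}(T_d)$ and its spinal generating set is $S=(A\cup B_\omega)\setminus\{1\}$. The Schreier graph $\Gamma_n$ has vertex set $X^n$ and, for every $v\in X^n$ and $s\in S$, a directed edge labeled $s$ from $v$ to $s(v)$ (loops and multiple edges allowed). Star operation: let $n\ge 0$, let $\Gamma$ be a graph with labeled edges and with vertices labeled by words in $X^n$, let $v$ be a vertex of $\Gamma$,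 and let $\Lambda$ be a finite graph on $d$ vertices $\lambda_i$, $i\in X$. Let $\tilde\Gamma$ be the graph $\Gamma$ with all loops at $v$ removed, and let $\tilde\Gamma_i$, $i\in X$, be $d$ disjoint copies of $\tilde\Gamma$, with $v_i\in\tilde\Gamma_i$ the vertex corresponding to $v$. Then $\operatorname{Star}(\Lambda,\Gamma,v)$ is obtained from $\Lambda\sqcup\bigsqcup_{i\in X}\tilde\Gamma_i$ by identifying $\lambda_i$ with $v_i$ for every $i\in X$. No edges are identified, all edges keep their labels, and the vertex of $\tilde\Gamma_i$ corresponding to the vertex of $\Gamma$ labeled $w$ gets the label $wi$. For $\Theta$ and $\Lambda_\pi$, $\lambda_i$ is the vertex labeled $i$.
   Formalization: In the formula for Γ_1 the loops of Ξ at ∅ are kept when its copies are attached to Θ; with Star as defined they would all be removed, and the stated equality for Γ_1 would be false. *)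

theory Defs
  imports "HOL-Algebra.Algebra" "HOL-Library.Multiset"
begin

section \<open>The \<open>d\<close>-ary rooted tree and its automorphism group\<close>

text \<open>Words over \<open>X = {0, \<dots>, d - 1}\<close> are lists, the first letter being the head; the word \<open>wi\<close> is \<open>w @ [i]\<close>.\<close>

definition words :: "nat \<Rightarrow> nat list set" where
  "words d = {w. set w \<subseteq> {..<d}}"

definition level :: "nat \<Rightarrow> nat \<Rightarrow> nat list set" where
  "level d n = {w \<in> words d. length w = n}"

definition tree_adj :: "nat list \<Rightarrow> nat list \<Rightarrow> bool" where
  "tree_adj u w \<longleftrightarrow> (\<exists>x. w = u @ [x] \<or> u = w @ [x])"

text \<open>Automorphisms are extensional functions (elements of \<^const>\<open>Bij\<close>), so that equality of
  automorphisms is equality of functions.\<close>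

definition tree_aut :: "nat \<Rightarrow> (nat list \<Rightarrow> nat list) monoid" where
  "tree_aut d = (BijGroup (words d))
     \<lparr>carrier := {g \<in> Bij (words d). g [] = [] \<and>
        (\<forall>u \<in> words d. \<forall>w \<in> words d. tree_adj (g u) (g w) \<longleftrightarrow> tree_adj u w)}\<rparr>"


section \<open>Spinal groups\<close>

definition rooted_a :: "nat \<Rightarrow> nat list \<Rightarrow> nat list" where
  "rooted_a d = (\<lambda>w \<in> words d. case w of [] \<Rightarrow> [] | v # vs \<Rightarrow> ((v + 1) mod d) # vs)"

definition groupA :: "nat \<Rightarrow> (nat list \<Rightarrow> nat list) monoid" where
  "groupA d = subgroup_generated (tree_aut d) {rooted_a d}"

definition groupB :: "nat \<Rightarrow> nat \<Rightarrow> (nat \<Rightarrow> int) monoid" where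
  "groupB d m = product_group {..<m} (\<lambda>_. integer_mod_group d)"

definition Omega :: "nat \<Rightarrow> nat \<Rightarrow> (nat \<Rightarrow> (nat \<Rightarrow> int) \<Rightarrow> nat list \<Rightarrow> nat list) set" where
  "Omega d m = {\<omega>. (\<forall>n. \<omega> n \<in> epi (groupB d m) (groupA d)) \<and>
     (\<forall>i. (\<Inter>j \<in> {i..}. kernel (groupB d m) (groupA d) (\<omega> j)) = {\<one>\<^bsub>groupB d m\<^esub>})}"

text \<open>The action of an automorphism on the letters, i.e. on the first level.\<close>

definition letter_act :: "(nat list \<Rightarrow> nat list) \<Rightarrow> nat \<Rightarrow> nat" where
  "letter_act g x = hd (g [x])"

text \<open>The automorphism \<open>b\<^sub>\<omega>\<close>. Here \<open>r\<close> is the length of the longest prefix of \<open>w\<close> consisting of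
  letters \<open>d - 1\<close>. Since \<open>d - 1 \<noteq> 0\<close> for \<open>d \<ge> 2\<close>, the word \<open>w\<close> begins with \<open>(d - 1)\<^sup>r0v\<^sub>r\<^sub>+\<^sub>1\<close> for
  some \<open>r\<close> iff it does so for this \<open>r\<close>.\<close>

definition spinal_elt ::
  "nat \<Rightarrow> (nat \<Rightarrow> (nat \<Rightarrow> int) \<Rightarrow> nat list \<Rightarrow> nat list) \<Rightarrow> (nat \<Rightarrow> int) \<Rightarrow> nat list \<Rightarrow> nat list" where
  "spinal_elt d \<omega> b = (\<lambda>w \<in> words d.
     let r = length (takeWhile (\<lambda>x. x = d - 1) w)
     in if r + 1 < length w \<and> w ! r = 0
        then w[r + 1 := letter_act (\<omega> r b) (w ! (r + 1))]
        else w)"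

definition groupB_omega ::
  "nat \<Rightarrow> nat \<Rightarrow> (nat \<Rightarrow> (nat \<Rightarrow> int) \<Rightarrow> nat list \<Rightarrow> nat list) \<Rightarrow> (nat list \<Rightarrow> nat list) set" where
  "groupB_omega d m \<omega> = spinal_elt d \<omega> ` carrier (groupB d m)"

definition spinal_group ::
  "nat \<Rightarrow> nat \<Rightarrow> (nat \<Rightarrow> (nat \<Rightarrow> int) \<Rightarrow> nat list \<Rightarrow> nat list) \<Rightarrow> (nat list \<Rightarrow> nat list) monoid" where
  "spinal_group d m \<omega> =
     subgroup_generated (tree_aut d) (carrier (groupA d) \<union> groupB_omega d m \<omega>)"

definition spinal_gens ::
  "nat \<Rightarrow> nat \<Rightarrow> (nat \<Rightarrow> (nat \<Rightarrow> int) \<Rightarrow> nat list \<Rightarrow> nat list) \<Rightarrow> (nat list \<Rightarrow> nat list) set" where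
  "spinal_gens d m \<omega> =
     (carrier (groupA d) \<union> groupB_omega d m \<omega>) - {\<one>\<^bsub>tree_aut d\<^esub>}"


section \<open>Labelled graphs and the star operation\<close>

text \<open>A finite directed multigraph with distinctly labelled vertices and with labelled edges. A vertex
  is identified with its label, and \<open>(u, l, v)\<close> is an edge labelled \<open>l\<close> from \<open>u\<close> to \<open>v\<close>. The edges
  form a multiset, so parallel edges with the same label are counted separately, and equality of
  such graphs is isomorphism respecting vertex labels and edge labels.\<close>

record ('v, 'l) lgraph =
  verts :: "'v set"
  edges :: "('v \<times> 'l \<times> 'v) multiset"

definition schreier_graph :: "('v \<Rightarrow> 'v) set \<Rightarrow> 'v set \<Rightarrow> ('v, 'v \<Rightarrow> 'v) lgraph" where
  "schreier_graph S V =
     \<lparr>verts = V, edges = image_mset (\<lambda>(v, s). (v, s, s v)) (mset_set (V \<times> S))\<rparr>"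

definition remove_loops :: "'v \<Rightarrow> ('v, 'l) lgraph \<Rightarrow> ('v, 'l) lgraph" where
  "remove_loops v \<Gamma> = \<Gamma>\<lparr>edges := filter_mset (\<lambda>(x, l, y). \<not> (x = v \<and> y = v)) (edges \<Gamma>)\<rparr>"

text \<open>One copy of \<open>\<Gamma>\<close> for each vertex \<open>i\<close> of \<open>\<Lambda>\<close>, its vertex \<open>w\<close> becoming \<open>wi\<close>; the vertex \<open>i\<close> of
  \<open>\<Lambda>\<close> is identified with the vertex \<open>vi\<close> of the \<open>i\<close>-th copy. No loops are removed.
  This operation is needed on its own: all edges of the graph \<open>\<Xi>\<close> below are loops at its only vertex,
  so \<open>Star \<Theta> \<Xi> \<emptyset>\<close>, in which these are removed, is just \<open>\<Theta>\<close>, whereas \<open>\<Gamma>\<^sub>1\<close> is \<open>\<Theta>\<close> with the loops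
  of \<open>\<Xi>\<close> at each vertex.\<close>

definition attach_copies ::
  "(nat, 'l) lgraph \<Rightarrow> (nat list, 'l) lgraph \<Rightarrow> nat list \<Rightarrow> (nat list, 'l) lgraph" where
  "attach_copies \<Lambda> \<Gamma> v =
     \<lparr>verts = {w @ [i] | w i. w \<in> verts \<Gamma> \<and> i \<in> verts \<Lambda>},
      edges = image_mset (\<lambda>(i, l, j). (v @ [i], l, v @ [j])) (edges \<Lambda>) +
        (\<Sum>i \<in> verts \<Lambda>. image_mset (\<lambda>(x, l, y). (x @ [i], l, y @ [i])) (edges \<Gamma>))\<rparr>"

definition Star ::
  "(nat, 'l) lgraph \<Rightarrow> (nat list, 'l) lgraph \<Rightarrow> nat list \<Rightarrow> (nat list, 'l) lgraph" where
  "Star \<Lambda> \<Gamma> v = attach_copies \<Lambda> (remove_loops v \<Gamma>) v"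


section \<open>The graphs \<open>\<Xi>\<close>, \<open>\<Theta>\<close> and \<open>\<Lambda>\<^sub>\<pi>\<close>\<close>

text \<open>As labels, elements \<open>b\<close> of \<open>B\<close> are identified with \<open>b\<^sub>\<omega>\<close>; the argument \<open>\<omega>\<close> of \<open>Xi\<close> and \<open>Lambda\<close>
  serves this purpose only.\<close>

definition Xi ::
  "nat \<Rightarrow> nat \<Rightarrow> (nat \<Rightarrow> (nat \<Rightarrow> int) \<Rightarrow> nat list \<Rightarrow> nat list)
     \<Rightarrow> (nat list, nat list \<Rightarrow> nat list) lgraph" where
  "Xi d m \<omega> =
     \<lparr>verts = {[]},
      edges = image_mset (\<lambda>b. ([], spinal_elt d \<omega> b, []))
        (mset_set (carrier (groupB d m) - {\<one>\<^bsub>groupB d m\<^esub>}))\<rparr>"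

definition Theta :: "nat \<Rightarrow> (nat, nat list \<Rightarrow> nat list) lgraph" where
  "Theta d =
     \<lparr>verts = {..<d},
      edges = image_mset (\<lambda>(i, j). (i, rooted_a d [^]\<^bsub>tree_aut d\<^esub> j, (i + j) mod d))
        (mset_set ({..<d} \<times> {1..d - 1}))\<rparr>"

text \<open>For \<open>g \<in> A\<close>, some \<open>j\<close> with \<open>g = a\<^sup>j\<close>. It is unique modulo \<open>d\<close>.\<close>

definition a_exponent :: "nat \<Rightarrow> (nat list \<Rightarrow> nat list) \<Rightarrow> nat" where
  "a_exponent d g = (SOME j. g = rooted_a d [^]\<^bsub>tree_aut d\<^esub> j)"

definition Lambda ::
  "nat \<Rightarrow> nat \<Rightarrow> (nat \<Rightarrow> (nat \<Rightarrow> int) \<Rightarrow> nat list \<Rightarrow> nat list)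
     \<Rightarrow> ((nat \<Rightarrow> int) \<Rightarrow> nat list \<Rightarrow> nat list) \<Rightarrow> (nat, nat list \<Rightarrow> nat list) lgraph" where
  "Lambda d m \<omega> \<pi> =
     \<lparr>verts = {..<d},
      edges = image_mset (\<lambda>(i, b). (i, spinal_elt d \<omega> b, (i + a_exponent d (\<pi> b)) mod d))
        (mset_set ({..<d} \<times> (carrier (groupB d m) - {\<one>\<^bsub>groupB d m\<^esub>})))\<rparr>"

end

theory Submission
  imports Defs
begin

text \<open>
  Every generator acts on a word \<open>wi\<close> through \<open>w\<close> alone, \<open>s(wi) = s(w)i\<close>, with one exception: for
  \<open>w = v = (d - 1)\<^sup>n\<^sup>-\<^sup>20\<close> the elements \<open>b\<^sub>\<omega>\<close> fix \<open>v\<close> and move the letter \<open>i\<close> by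
  \<open>\<omega>\<^sub>n\<^sub>-\<^sub>2(b)\<close>. Hence \<open>\<Gamma>\<^sub>n\<close> consists of \<open>d\<close> copies of \<open>\<Gamma>\<^sub>n\<^sub>-\<^sub>1\<close> in which the loops at \<open>v\<close>,
  all of them labelled by \<open>B\<close>, are replaced by the edges of \<open>\<Lambda>\<close>. Edge multiplicities agree because
  distinct \<open>b\<close> give distinct \<open>b\<^sub>\<omega>\<close> (the kernels of the \<open>\<omega>\<^sub>j\<close> intersect trivially) and no
  nontrivial power of \<open>a\<close>, which moves every first letter, is some \<open>b\<^sub>\<omega>\<close>. All edge multisets
  involved are therefore sets, and it suffices to compare these.
\<close>

section \<open>The cyclic group generated by the rooted automorphism\<close>

lemma tree_aut_simps [simp]:
  "\<one>\<^bsub>tree_aut d\<^esub> = (\<lambda>w \<in> words d. w)"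
  "x \<otimes>\<^bsub>tree_aut d\<^esub> y = x \<otimes>\<^bsub>BijGroup (words d)\<^esub> y"
  by (simp_all add: tree_aut_def BijGroup_def)

lemma Nil_in_words [simp]: "[] \<in> words d"
  and Cons_in_words [simp]: "x # w \<in> words d \<longleftrightarrow> x < d \<and> w \<in> words d"
  and append_in_words [simp]: "u @ w \<in> words d \<longleftrightarrow> u \<in> words d \<and> w \<in> words d"
  and replicate_in_words: "x < d \<Longrightarrow> replicate n x \<in> words d"
  by (auto simp: words_def)

lemma tree_aut_imp_Bij: "g \<in> carrier (tree_aut d) \<Longrightarrow> g \<in> Bij (words d)"
  by (simp add: tree_aut_def)

text \<open>The adjacency condition is an equivalence, so substituting preimages carries it over to
  inverses; composites inherit it directly. This yields a subgroup of the group of all bijections of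
  \<open>words d\<close>.\<close>

lemma group_tree_aut: "group (tree_aut d)"
proof -
  let ?C = "{g \<in> Bij (words d). g [] = [] \<and>
        (\<forall>u \<in> words d. \<forall>w \<in> words d. tree_adj (g u) (g w) \<longleftrightarrow> tree_adj u w)}"
  have "subgroup ?C (BijGroup (words d))"
  proof (rule group.subgroupI[OF group_BijGroup])
    show "?C \<subseteq> carrier (BijGroup (words d))" by (auto simp: BijGroup_def)
    have "(\<lambda>w\<in>words d. w) \<in> ?C" by (simp add: id_Bij)
    then show "?C \<noteq> {}" by blast
    fix g assume "g \<in> ?C"
    then have g: "g \<in> Bij (words d)" "g [] = []"
      and g_adj: "\<And>u w. u \<in> words d \<Longrightarrow> w \<in> words d \<Longrightarrow> tree_adj (g u) (g w) \<longleftrightarrow> tree_adj u w"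
      by blast+
    have bij: "bij_betw g (words d) (words d)" using g by (simp add: Bij_def)
    have g_inv: "g (inv_into (words d) g u) = u" "inv_into (words d) g u \<in> words d"
      if "u \<in> words d" for u
      using bij_betw_inv_into_right[OF bij that] Bij_inv_into_mem[OF g(1) that] by auto
    have "inv_into (words d) g [] = []"
      using g(2) bij_betw_inv_into_left[OF bij, of "[]"] by simp
    moreover have "tree_adj (inv_into (words d) g u) (inv_into (words d) g w) \<longleftrightarrow> tree_adj u w"
      if "u \<in> words d" "w \<in> words d" for u w
      using g_adj[OF g_inv(2)[OF that(1)] g_inv(2)[OF that(2)]] that by (simp only: g_inv(1))
    ultimately show "inv\<^bsub>BijGroup (words d)\<^esub> g \<in> ?C"
      using g(1) by (simp add: inv_BijGroup restrict_inv_into_Bij)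
    fix h assume "h \<in> ?C"
    then have h: "h \<in> Bij (words d)" "h [] = []"
      and h_adj: "\<And>u w. u \<in> words d \<Longrightarrow> w \<in> words d \<Longrightarrow> tree_adj (h u) (h w) \<longleftrightarrow> tree_adj u w"
      by blast+
    have "h u \<in> words d" if "u \<in> words d" for u
      using that h(1) Bij_imp_funcset by blast
    then show "g \<otimes>\<^bsub>BijGroup (words d)\<^esub> h \<in> ?C"
      using g h by (simp add: BijGroup_def compose_Bij compose_eq g_adj h_adj)
  qed
  then show ?thesis
    unfolding tree_aut_def by (rule subgroup.subgroup_is_group) (rule group_BijGroup)
qed

text \<open>Adding 1 modulo \<open>d\<close> permutes the letters, and two nonempty words are
  adjacent iff their first letters agree and their tails are adjacent.\<close>

lemma rooted_a_in_tree_aut: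
  assumes "d \<ge> 1" shows "rooted_a d \<in> carrier (tree_aut d)"
proof -
  have inj: "Suc v mod d = Suc v' mod d \<longleftrightarrow> v = v'" if "v < d" "v' < d" for v v'
    using that by (auto simp: mod_Suc split: if_splits)
  have adj: "tree_adj (x # xs) (y # ys) \<longleftrightarrow> x = y \<and> tree_adj xs ys"
    "tree_adj [] (y # ys) \<longleftrightarrow> ys = []" "tree_adj (y # ys) [] \<longleftrightarrow> ys = []"
    for x y and xs ys :: "nat list"
    by (auto simp: tree_adj_def)
  have tree: "tree_adj (rooted_a d u) (rooted_a d w) \<longleftrightarrow> tree_adj u w"
    if "u \<in> words d" "w \<in> words d" for u w
    using that by (cases u; cases w) (simp_all add: rooted_a_def adj inj)
  have "inj_on (rooted_a d) (words d)"
    by (rule inj_onI) (auto simp: rooted_a_def inj split: list.splits)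
  moreover have "rooted_a d ` words d = words d"
  proof
    show "rooted_a d ` words d \<subseteq> words d"
      using assms by (auto simp: rooted_a_def split: list.splits)
    show "words d \<subseteq> rooted_a d ` words d"
    proof
      fix w assume w: "w \<in> words d"
      show "w \<in> rooted_a d ` words d"
      proof (cases w)
        case Nil
        then show ?thesis by (auto simp: rooted_a_def intro!: image_eqI[of _ _ "[]"])
      next
        case (Cons v vs)
        \<comment> \<open>Adding \<open>d - 1\<close> gives the predecessor modulo \<open>d\<close>
          without subtraction on naturals.\<close>
        with w assms show ?thesis
          by (intro image_eqI[of _ _ "((v + (d - 1)) mod d) # vs"]) (simp_all add: rooted_a_def mod_Suc_eq)
      qed
    qed
  qed
  moreover have "rooted_a d \<in> extensional (words d)"
    by (simp add: rooted_a_def)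
  ultimately have "rooted_a d \<in> Bij (words d)"
    by (simp add: Bij_def bij_betw_def)
  then show ?thesis
    using tree by (simp add: tree_aut_def rooted_a_def[of d, THEN fun_cong, of "[]"])
qed

lemma rooted_a_pow:
  assumes "d \<ge> 1"
  shows "rooted_a d [^]\<^bsub>tree_aut d\<^esub> (j::nat) =
    (\<lambda>w \<in> words d. case w of [] \<Rightarrow> [] | v # vs \<Rightarrow> ((v + j) mod d) # vs)"
proof (induction j)
  case 0
  have "w = (case w of [] \<Rightarrow> [] | v # vs \<Rightarrow> ((v + 0) mod d) # vs)" if "w \<in> words d" for w
    using that by (cases w) simp_all
  then show ?case
    unfolding nat_pow_0 tree_aut_simps by (rule restrict_ext)
next
  case (Suc j)
  interpret group "tree_aut d" by (rule group_tree_aut)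
  let ?p = "rooted_a d [^]\<^bsub>tree_aut d\<^esub> j"
  \<comment> \<open>Multiplication in \<open>BijGroup\<close> is restricted to \<open>Bij\<close>,
    so both factors must be known to lie there before it unfolds to \<open>compose\<close>.\<close>
  have "rooted_a d \<in> Bij (words d)" "?p \<in> Bij (words d)"
    by (intro tree_aut_imp_Bij nat_pow_closed rooted_a_in_tree_aut assms)+
  then have "rooted_a d [^]\<^bsub>tree_aut d\<^esub> Suc j = compose (words d) ?p (rooted_a d)"
    by (simp only: nat_pow_Suc tree_aut_simps) (simp add: BijGroup_def)
  also have "\<dots> = (\<lambda>w \<in> words d. case w of [] \<Rightarrow> [] | v # vs \<Rightarrow> ((v + Suc j) mod d) # vs)"
    unfolding compose_def
  proof (rule restrict_ext)
    fix w assume "w \<in> words d"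
    then show "?p (rooted_a d w) = (case w of [] \<Rightarrow> [] | v # vs \<Rightarrow> ((v + Suc j) mod d) # vs)"
      using assms unfolding Suc.IH
      by (cases w) (simp_all add: rooted_a_def mod_add_left_eq[of "Suc _" d j, simplified])
  qed
  finally show ?case .
qed

lemma rooted_a_pow_Cons:
  assumes "v < d" "vs \<in> words d"
  shows "(rooted_a d [^]\<^bsub>tree_aut d\<^esub> (j::nat)) (v # vs) = ((v + j) mod d) # vs"
  using assms by (simp add: rooted_a_pow)

lemma letter_act_rooted_a_pow:
  "x < d \<Longrightarrow> letter_act (rooted_a d [^]\<^bsub>tree_aut d\<^esub> (j::nat)) x = (x + j) mod d"
  by (simp add: letter_act_def rooted_a_pow_Cons)

lemma rooted_a_pow_mod:
  "d \<ge> 1 \<Longrightarrow> rooted_a d [^]\<^bsub>tree_aut d\<^esub> (j mod d) = rooted_a d [^]\<^bsub>tree_aut d\<^esub> (j::nat)"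
  by (simp add: rooted_a_pow mod_simps cong: list.case_cong)

text \<open>The image of the letter 0 reads off the exponent. This gives injectivity of the powers
  below \<open>d\<close> and an equality test in \<open>A\<close>.\<close>

lemma letter_act_rooted_a_pow_0:
  "j < d \<Longrightarrow> letter_act (rooted_a d [^]\<^bsub>tree_aut d\<^esub> (j::nat)) 0 = j"
  by (simp add: letter_act_rooted_a_pow)

lemma inj_on_rooted_a_pow: "inj_on (\<lambda>j::nat. rooted_a d [^]\<^bsub>tree_aut d\<^esub> j) {..<d}"
  by (rule inj_on_inverseI[where g = "\<lambda>g. letter_act g 0"]) (simp add: letter_act_rooted_a_pow_0)

text \<open>From \<open>a\<close> to the power \<open>d\<close> being trivial, the order is finite;
  hence natural exponents exhaust the generated group, and they reduce modulo
  \<open>d\<close>.\<close>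

lemma carrier_groupA:
  assumes "d \<ge> 1"
  shows "carrier (groupA d) = (\<lambda>j::nat. rooted_a d [^]\<^bsub>tree_aut d\<^esub> j) ` {..<d}"
proof -
  interpret group "tree_aut d" by (rule group_tree_aut)
  note a = rooted_a_in_tree_aut[OF assms]
  have "rooted_a d [^]\<^bsub>tree_aut d\<^esub> d = \<one>\<^bsub>tree_aut d\<^esub>"
    using rooted_a_pow_mod[OF assms, of d] by (simp only: mod_self nat_pow_0)
  then have "ord (rooted_a d) dvd d"
    using pow_eq_id[OF a] by blast
  \<comment> \<open>Order 0 stands for infinite order; 0 divides \<open>d\<close> only if
    \<open>d = 0\<close>.\<close>
  then have "ord (rooted_a d) \<noteq> 0"
    using assms by (intro notI) simp
  then have "generate (tree_aut d) {rooted_a d} = range (\<lambda>j::nat. rooted_a d [^]\<^bsub>tree_aut d\<^esub> j)"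
    using generate_pow_nat[OF a] by blast
  moreover have "carrier (tree_aut d) \<inter> {rooted_a d} = {rooted_a d}"
    using a by blast
  ultimately have "carrier (groupA d) = range (\<lambda>j::nat. rooted_a d [^]\<^bsub>tree_aut d\<^esub> j)"
    by (simp only: groupA_def carrier_subgroup_generated)
  also have "\<dots> = (\<lambda>j::nat. rooted_a d [^]\<^bsub>tree_aut d\<^esub> j) ` {..<d}"
  proof
    show "range (\<lambda>j::nat. rooted_a d [^]\<^bsub>tree_aut d\<^esub> j) \<subseteq>
        (\<lambda>j::nat. rooted_a d [^]\<^bsub>tree_aut d\<^esub> j) ` {..<d}"
    proof (rule image_subsetI)
      fix j :: nat
      show "rooted_a d [^]\<^bsub>tree_aut d\<^esub> j \<in> (\<lambda>j::nat. rooted_a d [^]\<^bsub>tree_aut d\<^esub> j) ` {..<d}"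
        using assms by (intro image_eqI[where x = "j mod d"] rooted_a_pow_mod[symmetric]) simp_all
    qed
  qed blast
  finally show ?thesis .
qed

lemma a_exponent:
  assumes "d \<ge> 1" "g \<in> carrier (groupA d)"
  shows "g = rooted_a d [^]\<^bsub>tree_aut d\<^esub> a_exponent d g"
proof -
  have "\<exists>j::nat. g = rooted_a d [^]\<^bsub>tree_aut d\<^esub> j"
    using assms(2) unfolding carrier_groupA[OF assms(1)] by blast
  then show ?thesis
    unfolding a_exponent_def by (rule someI_ex)
qed

text \<open>Links the exponent chosen in \<open>Lambda\<close> to the letter action in
  \<open>spinal_elt\<close>. The chosen exponent is known only modulo \<open>d\<close>, which is all
  that matters here.\<close>

lemma letter_act_groupA:
  assumes "d \<ge> 1" "g \<in> carrier (groupA d)" "x < d"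
  shows "letter_act g x = (x + a_exponent d g) mod d"
  by (rule letter_act_rooted_a_pow[OF assms(3), of "a_exponent d g",
        folded a_exponent[OF assms(1,2)]])

lemma groupA_eqI:
  assumes "d \<ge> 1" "g \<in> carrier (groupA d)" "h \<in> carrier (groupA d)"
    and "letter_act g 0 = letter_act h 0"
  shows "g = h"
proof -
  obtain i j where "g = rooted_a d [^]\<^bsub>tree_aut d\<^esub> i" "i < d"
    "h = rooted_a d [^]\<^bsub>tree_aut d\<^esub> j" "j < d"
    using assms(2,3) unfolding carrier_groupA[OF assms(1)] by blast
  then show ?thesis
    using assms(4) by (simp only: letter_act_rooted_a_pow_0)
qed


section \<open>The elements \<open>b\<^sub>\<omega>\<close>\<close>

lemma group_groupB: "group (groupB d m)"
  by (simp add: groupB_def)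

lemma finite_groupB: "d \<ge> 1 \<Longrightarrow> finite (carrier (groupB d m))"
  by (auto simp: groupB_def carrier_integer_mod_group intro: finite_PiE)

lemma group_groupA: "group (groupA d)"
  by (simp add: groupA_def group.group_subgroup_generated group_tree_aut)

lemma Omega_apply:
  assumes "\<omega> \<in> Omega d m" "b \<in> carrier (groupB d m)"
  shows "\<omega> n b \<in> carrier (groupA d)"
  using assms by (auto simp: Omega_def epi_def hom_def)

lemma takeWhile_eq_replicate_append:
  assumes "y \<noteq> x"
  shows "takeWhile (\<lambda>z. z = x) (replicate r x @ y # ys) = replicate r x"
  using assms by (induction r) auto

text \<open>As \<open>d \<ge> 2\<close>, the letter 0 differs from \<open>d - 1\<close>, so the
  maximal prefix has length exactly \<open>r\<close> and \<open>\<omega> r\<close> acts on the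
  letter behind the 0.\<close>

lemma spinal_elt_replicate:
  assumes "d \<ge> 2" "x < d"
  shows "spinal_elt d \<omega> b (replicate r (d - 1) @ [0, x]) =
    replicate r (d - 1) @ [0, letter_act (\<omega> r b) x]"
  using assms
  by (simp add: spinal_elt_def takeWhile_eq_replicate_append replicate_in_words nth_append
      list_update_append Let_def)

text \<open>No letter follows the 0, so there is nothing to move. This makes the gluing vertex a
  common fixed point of \<open>B\<close>.\<close>

lemma spinal_elt_replicate_zero:
  assumes "d \<ge> 2"
  shows "spinal_elt d \<omega> b (replicate r (d - 1) @ [0]) = replicate r (d - 1) @ [0]"
  using assms
  by (simp add: spinal_elt_def takeWhile_eq_replicate_append replicate_in_words Let_def)

text \<open>Evaluation at the prefix of length \<open>r\<close> followed by 0, 0 recovers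
  \<open>\<omega> r b\<close>. If two elements agree at all these words, their quotient lies in
  every kernel and is trivial by the condition in \<open>Omega\<close> at
  \<open>i = 0\<close>.\<close>

lemma inj_on_spinal_elt:
  assumes "d \<ge> 2" "\<omega> \<in> Omega d m"
  shows "inj_on (spinal_elt d \<omega>) (carrier (groupB d m))"
proof (rule inj_onI)
  interpret B: group "groupB d m" by (rule group_groupB)
  fix b b' assume b: "b \<in> carrier (groupB d m)" "b' \<in> carrier (groupB d m)"
    and eq: "spinal_elt d \<omega> b = spinal_elt d \<omega> b'"
  have "b \<otimes>\<^bsub>groupB d m\<^esub> inv\<^bsub>groupB d m\<^esub> b' \<in> kernel (groupB d m) (groupA d) (\<omega> r)" for r
  proof -
    interpret group_hom "groupB d m" "groupA d" "\<omega> r"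
      using assms(2) by (simp add: group_hom_def group_hom_axioms_def group_groupA group_groupB
          Omega_def epi_def)
    have "letter_act (\<omega> r b) 0 = letter_act (\<omega> r b') 0"
      using fun_cong[OF eq, of "replicate r (d - 1) @ [0, 0]"] assms(1)
      by (simp add: spinal_elt_replicate del: One_nat_def)
    then have "\<omega> r b = \<omega> r b'"
      using assms b by (intro groupA_eqI[of d]) (auto intro: Omega_apply)
    then show ?thesis
      using b by (simp add: kernel_def)
  qed
  then have "b \<otimes>\<^bsub>groupB d m\<^esub> inv\<^bsub>groupB d m\<^esub> b' \<in> (\<Inter>j\<in>{0..}. kernel (groupB d m) (groupA d) (\<omega> j))"
    by simp
  then have "b \<otimes>\<^bsub>groupB d m\<^esub> inv\<^bsub>groupB d m\<^esub> b' = \<one>\<^bsub>groupB d m\<^esub>"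
    using assms(2) unfolding Omega_def by blast
  then show "b = b'"
    using b by (metis B.inv_equality B.inv_inv B.inv_closed)
qed

lemma spinal_elt_one:
  assumes "d \<ge> 2" "\<omega> \<in> Omega d m"
  shows "spinal_elt d \<omega> \<one>\<^bsub>groupB d m\<^esub> = \<one>\<^bsub>tree_aut d\<^esub>"
proof -
  have "\<omega> r \<one>\<^bsub>groupB d m\<^esub> = \<one>\<^bsub>tree_aut d\<^esub>" for r
    using hom_one[OF _ group_groupB group_groupA, of "\<omega> r" d m d] assms(2)
    by (simp add: Omega_def epi_def groupA_def)
  then have "letter_act (\<omega> r \<one>\<^bsub>groupB d m\<^esub>) x = x" if "x < d" for r x
    using that by (simp add: letter_act_def)
  \<comment> \<open>The identity of \<open>tree_aut d\<close> is \<open>undefined\<close> off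
    \<open>words d\<close>, so its letter action is known only for letters below
    \<open>d\<close>.\<close>
  moreover have "w ! k < d" if "w \<in> words d" "k < length w" for w k
    using that nth_mem[of k w] unfolding words_def by blast
  ultimately show ?thesis
    by (auto simp: spinal_elt_def fun_eq_iff Let_def)
qed

lemma spinal_elt_singleton: "x < d \<Longrightarrow> spinal_elt d \<omega> b [x] = [x]"
  by (simp add: spinal_elt_def Let_def)

text \<open>The appended letter can be moved only if it directly follows the 0 that ends the maximal
  prefix. The excluded \<open>w\<close> is the one word of its length for which this
  happens.\<close>

lemma spinal_elt_snoc:
  assumes "w \<in> words d" "x < d" "w \<noteq> replicate (length w - 1) (d - 1) @ [0]"
  shows "spinal_elt d \<omega> b (w @ [x]) = spinal_elt d \<omega> b w @ [x]"
proof (cases "\<forall>z\<in>set w. z = d - 1")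
  case True
  then have "takeWhile (\<lambda>z. z = d - 1) w = w" by (simp add: takeWhile_eq_all_conv)
  then have "length (takeWhile (\<lambda>z. z = d - 1) w) = length w"
    by (rule arg_cong)
  \<comment> \<open>The prefix swallows all of \<open>w\<close>, so the position
    \<open>r + 1\<close> lies beyond the end, both before and after appending.\<close>
  moreover have "length (takeWhile (\<lambda>z. z = d - 1) (w @ [x])) \<ge> length w"
    using True by (simp add: takeWhile_append del: One_nat_def)
  ultimately show ?thesis
    using assms(1,2) by (simp add: spinal_elt_def Let_def del: One_nat_def)
next
  case False
  then obtain us y ys where "w = us @ y # ys" "y \<noteq> d - 1" "\<forall>z\<in>set us. z = d - 1"
    using split_list_first_prop[of w "\<lambda>z. z \<noteq> d - 1"] by blast
  moreover from this have "us = replicate (length us) (d - 1)"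
    by (intro replicate_eqI) auto
  ultimately obtain r where w: "w = replicate r (d - 1) @ y # ys" and y: "y \<noteq> d - 1"
    by metis
  have r: "takeWhile (\<lambda>z. z = d - 1) (replicate r (d - 1) @ y # zs) = replicate r (d - 1)" for zs
    using y by (rule takeWhile_eq_replicate_append)
  have words: "replicate r (d - 1) @ y # ys \<in> words d" "replicate r (d - 1) @ y # ys @ [x] \<in> words d"
    using assms(1,2) w by simp_all
  \<comment> \<open>Otherwise \<open>w\<close> would be the excluded word.\<close>
  have "y \<noteq> 0" if "ys = []"
    using assms(3) that by (auto simp: w)
  with words show ?thesis
    unfolding w spinal_elt_def Let_def append_assoc append_Cons restrict_def r
    by (cases ys) (simp_all only: length_append length_replicate length_Cons if_True nth_append_length
        list_update_append if_False list.size append.simps, auto simp: nth_append)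
qed

text \<open>Both parametrizations are injective and send 0, respectively the unit of
  \<open>B\<close>, to the identity; so deleting the identity deletes exactly one parameter from
  each.\<close>

lemma spinal_gens_eq:
  assumes "d \<ge> 2" "\<omega> \<in> Omega d m"
  shows "spinal_gens d m \<omega> =
    (\<lambda>j::nat. rooted_a d [^]\<^bsub>tree_aut d\<^esub> j) ` {1..d - 1} \<union>
    spinal_elt d \<omega> ` (carrier (groupB d m) - {\<one>\<^bsub>groupB d m\<^esub>})"
proof -
  interpret B: group "groupB d m" by (rule group_groupB)
  let ?p = "\<lambda>j::nat. rooted_a d [^]\<^bsub>tree_aut d\<^esub> j"
  have "{1..d - 1} = {..<d} - {0}" using assms(1) by auto
  moreover have "?p ` ({..<d} - {0}) = ?p ` {..<d} - ?p ` {0}"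
    using assms(1) by (intro inj_on_image_set_diff[OF inj_on_rooted_a_pow]) auto
  moreover have "carrier (groupA d) = ?p ` {..<d}"
    using assms(1) by (simp add: carrier_groupA)
  ultimately have A: "?p ` {1..d - 1} = carrier (groupA d) - {\<one>\<^bsub>tree_aut d\<^esub>}"
    by (simp only: image_insert image_empty nat_pow_0)
  have "spinal_elt d \<omega> ` (carrier (groupB d m) - {\<one>\<^bsub>groupB d m\<^esub>}) =
    spinal_elt d \<omega> ` carrier (groupB d m) - spinal_elt d \<omega> ` {\<one>\<^bsub>groupB d m\<^esub>}"
    by (intro inj_on_image_set_diff[OF inj_on_spinal_elt[OF assms]]) auto
  then have B: "spinal_elt d \<omega> ` (carrier (groupB d m) - {\<one>\<^bsub>groupB d m\<^esub>}) =
    groupB_omega d m \<omega> - {\<one>\<^bsub>tree_aut d\<^esub>}"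
    by (simp only: groupB_omega_def spinal_elt_one[OF assms] image_insert image_empty)
  show ?thesis
    unfolding spinal_gens_def A B by (rule Un_Diff)
qed

text \<open>The first letter changes because \<open>d\<close> does not divide
  \<open>j\<close>.\<close>

lemma rooted_a_pow_moves:
  assumes "w \<in> words d" "w \<noteq> []" "j \<in> {1..d - 1}"
  shows "(rooted_a d [^]\<^bsub>tree_aut d\<^esub> j) w \<noteq> w"
proof (cases w)
  case (Cons x xs)
  then have x: "x < d" "xs \<in> words d" using assms(1) by simp_all
  have "\<not> d dvd j" using assms(3) by (intro nat_dvd_not_less) auto
  then have "(x + j) mod d \<noteq> x mod d"
    using mod_eq_dvd_iff_nat[of x "x + j" d] by simp
  with x show ?thesis
    by (simp only: Cons rooted_a_pow_Cons mod_less list.inject simp_thms)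
qed (use assms in simp)

text \<open>The word \<open>[0]\<close> separates them: it is moved by the first and fixed by the
  second.\<close>

lemma rooted_a_pow_neq_spinal_elt:
  assumes "d \<ge> 2" "j \<in> {1..d - 1}"
  shows "rooted_a d [^]\<^bsub>tree_aut d\<^esub> j \<noteq> spinal_elt d \<omega> b"
  using assms rooted_a_pow_moves[of "[0]" d j] spinal_elt_singleton[of 0 d \<omega> b] by auto


section \<open>Edge multisets as sets\<close>

text \<open>Source and label determine an edge, so none is repeated. For infinite index sets both
  sides are empty.\<close>

lemma edges_schreier_graph:
  "edges (schreier_graph S V) = mset_set {(v, s, s v) | v s. v \<in> V \<and> s \<in> S}"
proof -
  have "(\<lambda>(v, s). (v, s, s v)) ` (V \<times> S) = {(v, s, s v) | v s. v \<in> V \<and> s \<in> S}" by auto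
  then show ?thesis
    by (simp add: schreier_graph_def image_mset_mset_set inj_on_def)
qed

lemma sum_mset_set_disjoint:
  assumes "finite I" "\<And>i. i \<in> I \<Longrightarrow> finite (F i)"
    and "\<And>i j. i \<in> I \<Longrightarrow> j \<in> I \<Longrightarrow> i \<noteq> j \<Longrightarrow> F i \<inter> F j = {}"
  shows "(\<Sum>i\<in>I. mset_set (F i)) = mset_set (\<Union>i\<in>I. F i)"
  using assms
proof (induction I rule: finite_induct)
  case (insert i I)
  have "F i \<inter> (\<Union>j\<in>I. F j) = {}" using insert.prems(2) insert.hyps by blast
  with insert show ?case by (simp add: mset_set_Union)
qed simp

text \<open>The last letter tells the copies apart. An edge of \<open>\<Lambda>\<close> can coincide
  with a copied edge only if both of its ends are \<open>v @ [i]\<close> for one \<open>i\<close>,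
  that is, if it is a loop matching a loop of \<open>\<Gamma>\<close> at \<open>v\<close> with the
  same label; \<open>disjoint\<close> rules this out.\<close>

lemma edges_attach_copies:
  assumes "finite (verts \<Lambda>)" "finite E" "finite F"
    and edges: "edges \<Lambda> = mset_set E" "edges \<Gamma> = mset_set F"
    and disjoint: "\<And>i l. (i, l, i) \<in> E \<Longrightarrow> (v, l, v) \<notin> F"
  shows "edges (attach_copies \<Lambda> \<Gamma> v) =
    mset_set ({(v @ [i], l, v @ [j]) | i l j. (i, l, j) \<in> E} \<union>
      {(x @ [i], l, y @ [i]) | x l y i. (x, l, y) \<in> F \<and> i \<in> verts \<Lambda>})"
proof -
  let ?e = "\<lambda>(i, l, j). (v @ [i], l, v @ [j])"
  let ?f = "\<lambda>i. \<lambda>(x, l, y). (x @ [i], l, y @ [i])"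
  have "edges (attach_copies \<Lambda> \<Gamma> v) =
      mset_set (?e ` E) + (\<Sum>i\<in>verts \<Lambda>. mset_set (?f i ` F))"
    by (simp add: attach_copies_def edges image_mset_mset_set inj_on_def split_def prod_eq_iff)
  also have "(\<Sum>i\<in>verts \<Lambda>. mset_set (?f i ` F)) = mset_set (\<Union>i\<in>verts \<Lambda>. ?f i ` F)"
    using assms(1,3) by (intro sum_mset_set_disjoint) auto
  also have "mset_set (?e ` E) + \<dots> = mset_set (?e ` E \<union> (\<Union>i\<in>verts \<Lambda>. ?f i ` F))"
    using assms(1-3) disjoint by (intro mset_set_Union[symmetric]) auto
  also have "?e ` E = {(v @ [i], l, v @ [j]) | i l j. (i, l, j) \<in> E}"
    by force
  also have "(\<Union>i\<in>verts \<Lambda>. ?f i ` F) =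
      {(x @ [i], l, y @ [i]) | x l y i. (x, l, y) \<in> F \<and> i \<in> verts \<Lambda>}"
    by force
  finally show ?thesis .
qed

section \<open>Edge sets of the building blocks, free of repetitions by injectivity of the
  labels\<close>

lemma edges_Xi:
  assumes "d \<ge> 2" "\<omega> \<in> Omega d m"
  shows "edges (Xi d m \<omega>) = mset_set
    {([], spinal_elt d \<omega> b, []) | b. b \<in> carrier (groupB d m) - {\<one>\<^bsub>groupB d m\<^esub>}}"
proof -
  let ?B = "carrier (groupB d m) - {\<one>\<^bsub>groupB d m\<^esub>}"
  have "inj_on (\<lambda>b. ([]::nat list, spinal_elt d \<omega> b, []::nat list)) ?B"
    using inj_on_spinal_elt[OF assms] by (auto simp: inj_on_def)
  moreover have "(\<lambda>b. ([]::nat list, spinal_elt d \<omega> b, []::nat list)) ` ?B =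
      {([], spinal_elt d \<omega> b, []) | b. b \<in> ?B}"
    by blast
  ultimately show ?thesis
    by (simp only: Xi_def lgraph.simps image_mset_mset_set)
qed

lemma edges_Theta:
  assumes "d \<ge> 2"
  shows "edges (Theta d) = mset_set
    {(i, rooted_a d [^]\<^bsub>tree_aut d\<^esub> j, (i + j) mod d) | i j. i < d \<and> j \<in> {1..d - 1}}"
proof -
  have "inj_on (\<lambda>j. rooted_a d [^]\<^bsub>tree_aut d\<^esub> j) {1..d - 1}"
    using assms by (intro inj_on_subset[OF inj_on_rooted_a_pow]) auto
  then have "inj_on (\<lambda>(i, j). (i, rooted_a d [^]\<^bsub>tree_aut d\<^esub> j, (i + j) mod d)) ({..<d} \<times> {1..d - 1})"
    by (auto simp: inj_on_def)
  moreover have "(\<lambda>(i, j). (i, rooted_a d [^]\<^bsub>tree_aut d\<^esub> j, (i + j) mod d)) ` ({..<d} \<times> {1..d - 1})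
    = {(i, rooted_a d [^]\<^bsub>tree_aut d\<^esub> j, (i + j) mod d) | i j. i < d \<and> j \<in> {1..d - 1}}"
    by auto
  ultimately show ?thesis
    by (simp add: Theta_def image_mset_mset_set)
qed

lemma edges_Lambda:
  assumes "d \<ge> 2" "\<omega> \<in> Omega d m"
  shows "edges (Lambda d m \<omega> \<pi>) = mset_set
    {(i, spinal_elt d \<omega> b, (i + a_exponent d (\<pi> b)) mod d) | i b.
      i < d \<and> b \<in> carrier (groupB d m) - {\<one>\<^bsub>groupB d m\<^esub>}}"
proof -
  let ?f = "\<lambda>(i, b). (i, spinal_elt d \<omega> b, (i + a_exponent d (\<pi> b)) mod d)"
  let ?B = "carrier (groupB d m) - {\<one>\<^bsub>groupB d m\<^esub>}"
  have "inj_on ?f ({..<d} \<times> ?B)"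
    using inj_on_spinal_elt[OF assms] by (auto simp: inj_on_def)
  moreover have "?f ` ({..<d} \<times> ?B) =
      {(i, spinal_elt d \<omega> b, (i + a_exponent d (\<pi> b)) mod d) | i b. i < d \<and> b \<in> ?B}"
    by auto
  ultimately show ?thesis
    by (simp add: Lambda_def image_mset_mset_set)
qed

section \<open>Levels, finiteness and the recursion for the Schreier graphs\<close>

lemma level_Suc: "level d (Suc n) = {w @ [i] | w i. w \<in> level d n \<and> i < d}"
  by (force simp: level_def length_Suc_conv_rev)

lemma finite_level: "finite (level d n)"
  by (induction n) (auto simp: level_Suc level_def[of _ 0] finite_image_set2)

lemma finite_spinal_gens:
  "d \<ge> 1 \<Longrightarrow> finite (spinal_gens d m \<omega>)"
  by (simp add: spinal_gens_def groupB_omega_def carrier_groupA finite_groupB)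

theorem proposition3p2:
  fixes d m :: nat
    and \<omega> :: "nat \<Rightarrow> (nat \<Rightarrow> int) \<Rightarrow> nat list \<Rightarrow> nat list"
    and G :: "(nat list \<Rightarrow> nat list) monoid"
    and S :: "(nat list \<Rightarrow> nat list) set"
    and \<Gamma> :: "nat \<Rightarrow> (nat list, nat list \<Rightarrow> nat list) lgraph"
  assumes "d \<ge> 2" and "m \<ge> 1" and "\<omega> \<in> Omega d m"
    and "G = spinal_group d m \<omega>"
    and "S = spinal_gens d m \<omega>"
    and "\<And>n. \<Gamma> n = schreier_graph S (level d n)"
  shows "\<Gamma> 1 = attach_copies (Theta d) (Xi d m \<omega>) [] \<and>
    (\<forall>n \<ge> 2. \<Gamma> n =
       Star (Lambda d m \<omega> (\<omega> (n - 2))) (\<Gamma> (n - 1)) (replicate (n - 2) (d - 1) @ [0]))"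
proof (intro conjI allI impI)
  let ?B = "carrier (groupB d m) - {\<one>\<^bsub>groupB d m\<^esub>}"
  let ?a = "\<lambda>j::nat. rooted_a d [^]\<^bsub>tree_aut d\<^esub> j"
  have d: "d \<ge> 1" using \<open>d \<ge> 2\<close> by simp
  note S = \<open>S = spinal_gens d m \<omega>\<close>[unfolded spinal_gens_eq[OF \<open>d \<ge> 2\<close> \<open>\<omega> \<in> Omega d m\<close>]]
  have finite_S: "finite S"
    using finite_spinal_gens[OF d] assms(5) by simp
  have finite_B: "finite ?B"
    using finite_groupB[OF d] by simp
  have finite_Theta: "finite {(i, ?a j, (i + j) mod d) | i j. i < d \<and> j \<in> {1..d - 1}}"
    by (rule finite_image_set2) auto
  have finite_Lambda:
    "finite {(i, spinal_elt d \<omega> b, (i + a_exponent d (\<pi> b)) mod d) | i b. i < d \<and> b \<in> ?B}" for \<pi>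
    by (rule finite_image_set2) (use finite_B in auto)
  show "\<Gamma> 1 = attach_copies (Theta d) (Xi d m \<omega>) []"
  proof (rule lgraph.equality)
    have level_1: "level d 1 = {[i] | i. i < d}"
      using level_Suc[of d 0] by (auto simp: level_def)
    then show "verts (\<Gamma> 1) = verts (attach_copies (Theta d) (Xi d m \<omega>) [])"
      by (simp add: assms(6) schreier_graph_def attach_copies_def Theta_def Xi_def)
    have "edges (attach_copies (Theta d) (Xi d m \<omega>) []) =
      mset_set ({([] @ [i], l, [] @ [j]) | i l j.
          (i, l, j) \<in> {(i, ?a j, (i + j) mod d) | i j. i < d \<and> j \<in> {1..d - 1}}} \<union>
        {(x @ [i], l, y @ [i]) | x l y i.
          (x, l, y) \<in> {([], spinal_elt d \<omega> b, []) | b. b \<in> ?B} \<and> i \<in> verts (Theta d)})"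
      \<comment> \<open>Disjointness holds since \<open>Theta\<close> and \<open>Xi\<close> have no
        label in common.\<close>
      by (rule edges_attach_copies[OF _ finite_Theta _ edges_Theta edges_Xi])
        (use assms(1,3) finite_B rooted_a_pow_neq_spinal_elt[OF assms(1)] in \<open>auto simp: Theta_def\<close>)
    also have "\<dots> = mset_set ({([i], ?a j, [(i + j) mod d]) | i j. i < d \<and> j \<in> {1..d - 1}} \<union>
        {([i], spinal_elt d \<omega> b, [i]) | i b. i < d \<and> b \<in> ?B})"
      by (rule arg_cong[of _ _ mset_set]) (auto simp: Theta_def)
    \<comment> \<open>On one-letter words each \<open>b_\<omega>\<close> is trivial, which produces
      the loops, and powers of \<open>a\<close> act by addition.\<close>
    also have "\<dots> = mset_set {(v, s, s v) | v s. v \<in> level d 1 \<and> s \<in> S}"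
      unfolding S level_1
      by (rule arg_cong[of _ _ mset_set])
        (auto 4 4 simp: rooted_a_pow_Cons spinal_elt_singleton)
    finally show "edges (\<Gamma> 1) = edges (attach_copies (Theta d) (Xi d m \<omega>) [])"
      by (simp add: assms(6) edges_schreier_graph)
  qed simp
  fix n :: nat assume "2 \<le> n"
  \<comment> \<open>With \<open>k\<close> for \<open>n - 2\<close>, no truncated subtraction
    remains.\<close>
  then obtain k where n: "n = Suc (Suc k)"
    by (metis add_2_eq_Suc le_Suc_ex)
  define v where "v = replicate k (d - 1) @ [0]"
  have v: "v \<in> level d (Suc k)"
    using assms(1) by (simp add: v_def level_def replicate_in_words)
  define E where
    "E = {(i, spinal_elt d \<omega> b, (i + a_exponent d (\<omega> k b)) mod d) | i b. i < d \<and> b \<in> ?B}"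
  define F where
    "F = {(x, s, s x) | x s. x \<in> level d (Suc k) \<and> s \<in> S} - {(v, s, v) | s. True}"
  have spinal_v: "spinal_elt d \<omega> b v = v" for b
    using assms(1) unfolding v_def by (rule spinal_elt_replicate_zero)
  \<comment> \<open>Only the first letter changes, and \<open>w\<close> has one because its length
    is \<open>Suc k\<close>.\<close>
  have a_snoc: "?a j (w @ [i]) = ?a j w @ [i]" if "w \<in> level d (Suc k)" "i < d" for j w i
    using that by (cases w) (auto simp: level_def rooted_a_pow_Cons)
  \<comment> \<open>Together with \<open>spinal_v\<close>: the loops at \<open>v\<close> are exactly
    the edges there labelled by \<open>B\<close>.\<close>
  have a_v: "?a j v \<noteq> v" if "j \<in> {1..d - 1}" for j
    using v that by (intro rooted_a_pow_moves) (auto simp: level_def)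
  \<comment> \<open>The prefix of \<open>v\<close> has length \<open>k\<close>, hence the index
    \<open>n - 2\<close> in the recursion.\<close>
  have spinal_v_snoc: "spinal_elt d \<omega> b (v @ [i]) = v @ [(i + a_exponent d (\<omega> k b)) mod d]"
    if "b \<in> ?B" "i < d" for b i
    using that assms(1,3) letter_act_groupA[OF d Omega_apply[OF assms(3)], of b i k]
    by (simp add: v_def spinal_elt_replicate del: One_nat_def)
  have spinal_snoc: "spinal_elt d \<omega> b (w @ [i]) = spinal_elt d \<omega> b w @ [i]"
    if "w \<in> level d (Suc k)" "i < d" "w \<noteq> v" for b w i
    using that by (intro spinal_elt_snoc) (auto simp: level_def v_def)
  let ?R = "attach_copies (Lambda d m \<omega> (\<omega> k)) (remove_loops v (\<Gamma> (Suc k))) v"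
  have "\<Gamma> n = ?R"
  proof (rule lgraph.equality)
    show "verts (\<Gamma> n) = verts ?R"
      by (simp add: assms(6) schreier_graph_def attach_copies_def Lambda_def remove_loops_def
          n level_Suc[of d "Suc k"])
    have "edges (remove_loops v (\<Gamma> (Suc k))) = mset_set F"
      using finite_S finite_level
      by (auto simp: remove_loops_def assms(6) edges_schreier_graph F_def finite_image_set2
          intro!: arg_cong[of _ _ mset_set])
    \<comment> \<open>Disjointness is immediate here: \<open>F\<close> contains no loop at
      \<open>v\<close>.\<close>
    then have "edges ?R = mset_set ({(v @ [i], l, v @ [j]) | i l j. (i, l, j) \<in> E} \<union>
        {(x @ [i], l, y @ [i]) | x l y i. (x, l, y) \<in> F \<and> i \<in> verts (Lambda d m \<omega> (\<omega> k))})"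
      using edges_Lambda[OF assms(1,3), of "\<omega> k"] finite_Lambda finite_S finite_level
      by (intro edges_attach_copies) (auto simp: Lambda_def E_def F_def finite_image_set2)
    also have "\<dots> = mset_set {(u, s, s u) | u s. u \<in> level d n \<and> s \<in> S}"
    proof (intro arg_cong[of _ _ mset_set] equalityI subsetI)
      fix e assume "e \<in> {(v @ [i], l, v @ [j]) | i l j. (i, l, j) \<in> E} \<union>
        {(x @ [i], l, y @ [i]) | x l y i. (x, l, y) \<in> F \<and> i \<in> verts (Lambda d m \<omega> (\<omega> k))}"
      then consider
        (central) i b where "i < d" "b \<in> ?B"
          "e = (v @ [i], spinal_elt d \<omega> b, v @ [(i + a_exponent d (\<omega> k b)) mod d])"
        | (copy) x s i where "x \<in> level d (Suc k)" "s \<in> S" "x = v \<Longrightarrow> s v \<noteq> v" "i < d"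
          "e = (x @ [i], s, s x @ [i])"
        by (auto simp: E_def F_def Lambda_def)
      then show "e \<in> {(u, s, s u) | u s. u \<in> level d n \<and> s \<in> S}"
      proof cases
        case central
        then show ?thesis
          using v by (auto simp: S n level_Suc[of d "Suc k"] spinal_v_snoc)
      next
        case copy
        \<comment> \<open>For \<open>x = v\<close> the edge has survived the removal of loops, so
          \<open>s\<close> is a power of \<open>a\<close>.\<close>
        have "s (x @ [i]) = s x @ [i]"
          using copy(2) a_snoc[OF copy(1,4)] spinal_snoc[OF copy(1,4)] copy(3) spinal_v
          by (cases "x = v") (auto simp: S)
        then show ?thesis
          using copy by (auto simp: n level_Suc[of d "Suc k"])
      qed
    next
      fix e assume "e \<in> {(u, s, s u) | u s. u \<in> level d n \<and> s \<in> S}"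
      then obtain w i s where e: "w \<in> level d (Suc k)" "i < d" "s \<in> S"
        "e = (w @ [i], s, s (w @ [i]))"
        by (auto simp: n level_Suc[of d "Suc k"])
      show "e \<in> {(v @ [i], l, v @ [j]) | i l j. (i, l, j) \<in> E} \<union>
        {(x @ [i], l, y @ [i]) | x l y i. (x, l, y) \<in> F \<and> i \<in> verts (Lambda d m \<omega> (\<omega> k))}"
      \<comment> \<open>Exactly the edges that leave a gluing vertex with a label from
        \<open>B\<close> come from \<open>Lambda\<close>; all others come from a copy.\<close>
      proof (cases "\<exists>b\<in>?B. s = spinal_elt d \<omega> b \<and> w = v")
        case True
        then show ?thesis
          using e(2,4) spinal_v_snoc by (auto simp: E_def)
      next
        case False
        then have "s (w @ [i]) = s w @ [i]" "w = v \<Longrightarrow> s v \<noteq> v"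
          using e(3) a_snoc[OF e(1,2)] spinal_snoc[OF e(1,2)] a_v by (auto simp: S)
        then show ?thesis
          using e by (auto simp: F_def Lambda_def)
      qed
    qed
    finally show "edges (\<Gamma> n) = edges ?R"
      by (simp add: assms(6) edges_schreier_graph)
  qed simp
  then show "\<Gamma> n = Star (Lambda d m \<omega> (\<omega> (n - 2))) (\<Gamma> (n - 1)) (replicate (n - 2) (d - 1) @ [0])"
    by (simp add: Star_def n v_def)
qed

end
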